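(* Let $\alpha>0$, let $F$ be the distribution function of a positive random variable $X$ with $m(\alpha)=E(X^\alpha)<\infty$, assume that $F$ has a density $f$, and let $R(x)=\sum_{n=0}^{\infty}F^{\boxtimes n}(x)$ be the Kendall renewal function of $F$. If $xf(x)/\overline{F}(x)\to\beta$ as $x\to\infty$, where $\beta>\alpha$, then $$\lim_{x\to\infty}\frac{1}{x^{2\alpha-1}\overline{F}(x)}\left(R'(x)-\frac{2\alpha x^{\alpha-1}}{m(\alpha)}\right)=C,\qquad\text{where } C=\frac{(2\alpha-\beta)(3\alpha-\beta)}{m^{2}(\alpha)(\beta-\alpha)}.$$
   Context: Fix $\alpha>0$. $X$ is a positive random variable with distribution function $F(x)=P(X\le x)$, $F(0-)=0$, $F$ continuous; $\overline{F}=1-F$; $m(\alpha)=\int_0^\infty y^\alpha\,dF(y)$; $m^2(\alpha)$ means $(m(\alpha))^2$. The Williamson transform ($G$-transform) of a distribution function $F$ with $F(0-)=0$ is $G_F(x)=\int_0^x\bigl(1-(t/x)^\alpha\bigr)\,dF(t)$, $x>0$. The Kendall convolution $F_1\boxtimes F_2$ of two distribution functions with $F_i(0-)=0$ is the distribution function $F_3$ (with $F_3(0-)=0$) determined by $G_{F_3}(x)=G_{F_1}(x)G_{F_2}(x)$. The $n$-fold Kendall convolution $F^{\boxtimes n}$ is thus the distribution function with $G$-transform $G_F^n$, and $F^{\boxtimes 0}$ is the distribution function of the point mass at $0$. $R'$ is the derivative of $R$, understood at points $x$ where $F'(x)=f(x)$. *)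

theory Defs
  imports "HOL-Probability.Probability"
begin

definition distribution_function_nonneg :: "(real \<Rightarrow> real) \<Rightarrow> bool" where
  "distribution_function_nonneg F \<longleftrightarrow>
     mono F \<and> (\<forall>x. continuous (at_right x) F) \<and> (\<forall>x<0. F x = 0) \<and> (F \<longlongrightarrow> 1) at_top"

text \<open>The integral is taken over the closed interval, so an atom of \<open>F\<close> at \<open>0\<close> contributes;
  its integrand value there is \<open>1\<close>, as \<open>0 powr \<alpha> = 0\<close>.\<close>

definition williamson_transform :: "real \<Rightarrow> (real \<Rightarrow> real) \<Rightarrow> real \<Rightarrow> real" where
  "williamson_transform \<alpha> F x = (LINT t:{0..x}|interval_measure F. 1 - (t / x) powr \<alpha>)"

definition kendall_convolution ::
    "real \<Rightarrow> (real \<Rightarrow> real) \<Rightarrow> (real \<Rightarrow> real) \<Rightarrow> real \<Rightarrow> real" where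
  "kendall_convolution \<alpha> F1 F2 =
     (THE F3. distribution_function_nonneg F3 \<and>
        (\<forall>x>0. williamson_transform \<alpha> F3 x =
                williamson_transform \<alpha> F1 x * williamson_transform \<alpha> F2 x))"

primrec kendall_power :: "real \<Rightarrow> (real \<Rightarrow> real) \<Rightarrow> nat \<Rightarrow> real \<Rightarrow> real" where
  "kendall_power \<alpha> F 0 = cdf (return borel 0)"
| "kendall_power \<alpha> F (Suc n) = kendall_convolution \<alpha> F (kendall_power \<alpha> F n)"

definition kendall_renewal :: "real \<Rightarrow> (real \<Rightarrow> real) \<Rightarrow> real \<Rightarrow> real" where
  "kendall_renewal \<alpha> F x = (\<Sum>n. kendall_power \<alpha> F n x)"

text \<open>The points at which the density version \<open>f\<close> is the derivative of \<open>F\<close>; almost every real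
  number is such a point when \<open>f\<close> is a density of \<open>F\<close>.\<close>

definition density_points :: "(real \<Rightarrow> real) \<Rightarrow> (real \<Rightarrow> real) \<Rightarrow> real set" where
  "density_points F f = {x. (F has_real_derivative f x) (at x)}"

end

theory Submission
  imports Defs
begin

text \<open>
  Write \<open>G\<close> for the Williamson transform of \<open>F\<close>. By Fubini, \<open>x\<^sup>\<alpha> G(x)\<close> is a primitive of \<open>\<alpha> x\<^sup>\<alpha>\<^sup>-\<^sup>1 F(x)\<close>
  (\<open>williamson_has_integral\<close>). So \<open>F = G + x G' / \<alpha>\<close> recovers \<open>F\<close> from \<open>G\<close>, and the distribution function
  with transform \<open>G\<^sup>n\<close> is \<open>G\<^sup>n + n G\<^sup>n\<^sup>-\<^sup>1 (F - G)\<close> (\<open>kendall_power_eq\<close>). Its monotonicity rests on \<open>G \<le> F\<close>.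
  Summing over \<open>n\<close> gives
  \<open>R = 1 / (1 - G) + (F - G) / (1 - G)\<^sup>2\<close>, and since \<open>G' = \<alpha> (F - G) / x\<close>, wherever \<open>F' = f\<close>,
  \<open>R' = f / (1 - G)\<^sup>2 + 2 \<alpha> (F - G)\<^sup>2 / (x (1 - G)\<^sup>3)\<close>
  (\<open>kendall_renewal_has_derivative\<close>).

  For the asymptotics put \<open>u(x) = x\<^sup>\<alpha> (1 - F(x))\<close> and \<open>K(x) = \<integral>\<^sub>x\<^sup>\<infinity> \<alpha> s\<^sup>\<alpha>\<^sup>-\<^sup>1 (1 - F(s)) ds\<close>. Then
  \<open>1 - G = x\<^sup>-\<^sup>\<alpha> (m - K)\<close> and \<open>F - G = x\<^sup>-\<^sup>\<alpha> (m - K - u)\<close>. The tail moment \<open>T(x) = \<integral>\<^sub>x\<^sup>\<infinity> t\<^sup>\<alpha> f(t) dt\<close> equals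
  \<open>u + K\<close> by integration by parts, whereas \<open>t f(t) \<sim> \<beta> (1 - F(t))\<close> gives \<open>\<alpha> T \<sim> \<beta> K\<close>. Hence
  \<open>K / u \<rightarrow> a = \<alpha> / (\<beta> - \<alpha>)\<close> and \<open>u \<rightarrow> 0\<close> (\<open>tail_integral_asymptotics\<close>). After division by
  \<open>x\<^sup>2\<^sup>\<alpha>\<^sup>-\<^sup>1 (1 - F(x))\<close> the remainder of the renewal density is
  \<open>(x f / (1 - F)) / (m - K)\<^sup>2 + 2 \<alpha> ((m - K - u)\<^sup>2 / (m - K)\<^sup>3 - 1 / m) / u\<close>,
  which tends to \<open>(\<beta> + 2 \<alpha> (a - 2)) / m\<^sup>2\<close> (\<open>renewal_density_expansion\<close>); this is the stated constant.
\<close>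

section \<open>Layer-cake formulas for powers\<close>

text \<open>For \<open>\<alpha> < 1\<close> the integrand is unbounded at \<open>0\<close>, so the fundamental theorem is used in the form
  that asks for a derivative in the open interval only.\<close>

lemma powr_has_integral:
  fixes \<alpha> a b :: real
  assumes "\<alpha> > 0" "0 \<le> a" "a \<le> b"
  shows "((\<lambda>s. \<alpha> * s powr (\<alpha> - 1)) has_integral b powr \<alpha> - a powr \<alpha>) {a..b}"
proof (rule fundamental_theorem_of_calculus_interior)
  show "((\<lambda>s. s powr \<alpha>) has_vector_derivative \<alpha> * s powr (\<alpha> - 1)) (at s)" if "s \<in> {a<..<b}" for s
    unfolding has_real_derivative_iff_has_vector_derivative[symmetric]
    using that assms by (auto intro!: derivative_eq_intros)
  show "continuous_on {a..b} (\<lambda>s. s powr \<alpha>)"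
    using assms by (intro continuous_on_powr' continuous_on_id continuous_on_const) auto
qed fact

lemma nn_integral_powr_Icc:
  fixes \<alpha> a b :: real
  assumes "\<alpha> > 0" "0 \<le> a" "a \<le> b"
  shows "(\<integral>\<^sup>+s. ennreal (\<alpha> * s powr (\<alpha> - 1)) * indicator {a..b} s \<partial>lborel)
         = ennreal (b powr \<alpha> - a powr \<alpha>)"
  by (rule nn_integral_has_integral_lebesgue'[OF _ powr_has_integral[OF assms]]) (use assms in auto)

text \<open>Both layer-cake formulas write the difference of the two powers as the integral of
  \<open>\<alpha> s\<^sup>\<alpha>\<^sup>-\<^sup>1\<close> between \<open>t\<close> and \<open>x\<close> and exchange the order of integration. This one moves
  the Williamson transform from integration against \<open>F\<close> to integration of \<open>F\<close>.\<close>

lemma nn_integral_layer_cake_below: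
  fixes N :: "real measure" and \<alpha> x :: real
  assumes "sigma_finite_measure N" and [measurable_cong]: "sets N = sets borel"
    and "\<alpha> > 0" "x \<ge> 0"
  shows "(\<integral>\<^sup>+t. ennreal (x powr \<alpha> - t powr \<alpha>) * indicator {0..x} t \<partial>N)
       = (\<integral>\<^sup>+s. ennreal (\<alpha> * s powr (\<alpha> - 1)) * emeasure N {0..s} * indicator {0..x} s \<partial>lborel)"
proof -
  interpret N: sigma_finite_measure N by fact
  interpret P: pair_sigma_finite N lborel ..
  have "(\<integral>\<^sup>+t. ennreal (x powr \<alpha> - t powr \<alpha>) * indicator {0..x} t \<partial>N)
      = (\<integral>\<^sup>+t. (\<integral>\<^sup>+s. ennreal (\<alpha> * s powr (\<alpha> - 1)) *
           (if 0 \<le> t \<and> t \<le> s \<and> s \<le> x then 1 else 0) \<partial>lborel) \<partial>N)"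
  proof (rule nn_integral_cong)
    fix t :: real
    show "ennreal (x powr \<alpha> - t powr \<alpha>) * indicator {0..x} t
      = (\<integral>\<^sup>+s. ennreal (\<alpha> * s powr (\<alpha> - 1)) * (if 0 \<le> t \<and> t \<le> s \<and> s \<le> x then 1 else 0) \<partial>lborel)"
    proof (cases "t \<in> {0..x}")
      case True
      then have "(\<integral>\<^sup>+s. ennreal (\<alpha> * s powr (\<alpha> - 1)) * (if 0 \<le> t \<and> t \<le> s \<and> s \<le> x then 1 else 0) \<partial>lborel)
        = (\<integral>\<^sup>+s. ennreal (\<alpha> * s powr (\<alpha> - 1)) * indicator {t..x} s \<partial>lborel)"
        by (intro nn_integral_cong) (auto simp: indicator_def)
      with True assms show ?thesis by (simp add: nn_integral_powr_Icc)
    next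
      case False
      then have "(if 0 \<le> t \<and> t \<le> s \<and> s \<le> x then 1 else 0 :: ennreal) = 0" for s by auto
      with False show ?thesis by simp
    qed
  qed
  also have "\<dots> = (\<integral>\<^sup>+s. (\<integral>\<^sup>+t. ennreal (\<alpha> * s powr (\<alpha> - 1)) *
           (if 0 \<le> t \<and> t \<le> s \<and> s \<le> x then 1 else 0) \<partial>N) \<partial>lborel)"
    by (rule P.Fubini'[symmetric]) measurable
  also have "\<dots> = (\<integral>\<^sup>+s. ennreal (\<alpha> * s powr (\<alpha> - 1)) * emeasure N {0..s} * indicator {0..x} s \<partial>lborel)"
  proof (rule nn_integral_cong)
    fix s :: real
    have "(\<integral>\<^sup>+t. ennreal (\<alpha> * s powr (\<alpha> - 1)) * (if 0 \<le> t \<and> t \<le> s \<and> s \<le> x then 1 else 0) \<partial>N)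
      = (\<integral>\<^sup>+t. ennreal (\<alpha> * s powr (\<alpha> - 1)) * indicator {0..x} s * indicator {0..s} t \<partial>N)"
      by (intro nn_integral_cong) (auto simp: indicator_def)
    also have "\<dots> = ennreal (\<alpha> * s powr (\<alpha> - 1)) * indicator {0..x} s * emeasure N {0..s}"
      by (rule nn_integral_cmult_indicator) (simp add: assms(2))
    finally show "(\<integral>\<^sup>+t. ennreal (\<alpha> * s powr (\<alpha> - 1)) * (if 0 \<le> t \<and> t \<le> s \<and> s \<le> x then 1 else 0) \<partial>N)
      = ennreal (\<alpha> * s powr (\<alpha> - 1)) * emeasure N {0..s} * indicator {0..x} s"
      by (simp only: mult_ac)
  qed
  finally show ?thesis .
qed

text \<open>The companion for upper tails, which moves tail moments to integrals of the tail \<open>1 - F\<close>.\<close>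

lemma nn_integral_layer_cake_above:
  fixes N :: "real measure" and \<alpha> x :: real
  assumes "sigma_finite_measure N" and [measurable_cong]: "sets N = sets borel"
    and "\<alpha> > 0" "x \<ge> 0"
  shows "(\<integral>\<^sup>+t. ennreal (t powr \<alpha> - x powr \<alpha>) * indicator {x..} t \<partial>N)
       = (\<integral>\<^sup>+s. ennreal (\<alpha> * s powr (\<alpha> - 1)) * emeasure N {s..} * indicator {x..} s \<partial>lborel)"
proof -
  interpret N: sigma_finite_measure N by fact
  interpret P: pair_sigma_finite N lborel ..
  have "(\<integral>\<^sup>+t. ennreal (t powr \<alpha> - x powr \<alpha>) * indicator {x..} t \<partial>N)
      = (\<integral>\<^sup>+t. (\<integral>\<^sup>+s. ennreal (\<alpha> * s powr (\<alpha> - 1)) *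
           (if x \<le> s \<and> s \<le> t then 1 else 0) \<partial>lborel) \<partial>N)"
  proof (rule nn_integral_cong)
    fix t :: real
    show "ennreal (t powr \<alpha> - x powr \<alpha>) * indicator {x..} t
      = (\<integral>\<^sup>+s. ennreal (\<alpha> * s powr (\<alpha> - 1)) * (if x \<le> s \<and> s \<le> t then 1 else 0) \<partial>lborel)"
    proof (cases "x \<le> t")
      case True
      then have "(\<integral>\<^sup>+s. ennreal (\<alpha> * s powr (\<alpha> - 1)) * (if x \<le> s \<and> s \<le> t then 1 else 0) \<partial>lborel)
        = (\<integral>\<^sup>+s. ennreal (\<alpha> * s powr (\<alpha> - 1)) * indicator {x..t} s \<partial>lborel)"
        by (intro nn_integral_cong) (auto simp: indicator_def)
      with True assms show ?thesis by (simp add: nn_integral_powr_Icc)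
    next
      case False
      then have "(if x \<le> s \<and> s \<le> t then 1 else 0 :: ennreal) = 0" for s by auto
      with False show ?thesis by simp
    qed
  qed
  also have "\<dots> = (\<integral>\<^sup>+s. (\<integral>\<^sup>+t. ennreal (\<alpha> * s powr (\<alpha> - 1)) *
           (if x \<le> s \<and> s \<le> t then 1 else 0) \<partial>N) \<partial>lborel)"
    by (rule P.Fubini'[symmetric]) measurable
  also have "\<dots> = (\<integral>\<^sup>+s. ennreal (\<alpha> * s powr (\<alpha> - 1)) * emeasure N {s..} * indicator {x..} s \<partial>lborel)"
  proof (rule nn_integral_cong)
    fix s :: real
    have "(\<integral>\<^sup>+t. ennreal (\<alpha> * s powr (\<alpha> - 1)) * (if x \<le> s \<and> s \<le> t then 1 else 0) \<partial>N)
      = (\<integral>\<^sup>+t. ennreal (\<alpha> * s powr (\<alpha> - 1)) * indicator {x..} s * indicator {s..} t \<partial>N)"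
      by (intro nn_integral_cong) (auto simp: indicator_def)
    also have "\<dots> = ennreal (\<alpha> * s powr (\<alpha> - 1)) * indicator {x..} s * emeasure N {s..}"
      by (rule nn_integral_cmult_indicator) (simp add: assms(2))
    finally show "(\<integral>\<^sup>+t. ennreal (\<alpha> * s powr (\<alpha> - 1)) * (if x \<le> s \<and> s \<le> t then 1 else 0) \<partial>N)
      = ennreal (\<alpha> * s powr (\<alpha> - 1)) * emeasure N {s..} * indicator {x..} s"
      by (simp only: mult_ac)
  qed
  finally show ?thesis .
qed

section \<open>The Williamson transform of a distribution function\<close>

lemma real_distribution_interval_measure_nonneg:
  assumes "distribution_function_nonneg F"
  shows "real_distribution (interval_measure F)" "cdf (interval_measure F) = F"
proof -
  have "(F \<longlongrightarrow> 0) at_bot"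
    using assms eventually_at_bot_linorder[of "\<lambda>x. F x = 0"]
    by (intro tendsto_eventually) (auto simp: distribution_function_nonneg_def intro!: exI[of _ "-1"])
  with assms show "real_distribution (interval_measure F)" "cdf (interval_measure F) = F"
    by (auto simp: distribution_function_nonneg_def mono_def
        intro!: real_distribution_interval_measure cdf_interval_measure)
qed

lemma distribution_function_nonneg_bounds:
  assumes "distribution_function_nonneg F"
  shows "0 \<le> F x" "F x \<le> 1"
proof -
  interpret real_distribution "interval_measure F"
    by (rule real_distribution_interval_measure_nonneg[OF assms])
  show "0 \<le> F x" "F x \<le> 1"
    using cdf_nonneg[of x] cdf_bounded_prob[of x] real_distribution_interval_measure_nonneg(2)[OF assms]
    by simp_all
qed

text \<open>As \<open>F\<close> vanishes to the left of \<open>0\<close>, its left limit at \<open>0\<close> is \<open>0\<close>, and a jump at \<open>0\<close> is an atom inside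
  the closed interval.\<close>

lemma measure_interval_measure_nonneg:
  assumes "distribution_function_nonneg F"
  shows "measure (interval_measure F) {0..x} = F x"
proof (cases "x < 0")
  case True
  then show ?thesis using assms by (simp add: distribution_function_nonneg_def)
next
  case False
  interpret real_distribution "interval_measure F"
    by (rule real_distribution_interval_measure_nonneg[OF assms])
  have eq: "cdf (interval_measure F) = F"
    by (rule real_distribution_interval_measure_nonneg[OF assms])
  have "((\<lambda>y. 0) \<longlongrightarrow> measure (interval_measure F) {..<0}) (at_left (0::real))"
    using cdf_at_left[of 0]
    by (rule Lim_transform_eventually)
       (use assms in \<open>auto simp: eq eventually_at_filter distribution_function_nonneg_def\<close>)
  then have "measure (interval_measure F) {..<0} = 0"
    by (metis tendsto_const tendsto_unique trivial_limit_at_left_real)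
  moreover have "{..x} = {..<0} \<union> {0..x}" using False by auto
  moreover have "measure (interval_measure F) ({..<0} \<union> {0..x}) =
      measure (interval_measure F) {..<0} + measure (interval_measure F) {0..x}"
    by (rule finite_measure_Union) auto
  ultimately show ?thesis using eq by (metis cdf_def2 add_0)
qed

lemma distribution_function_nonneg_borel:
  "distribution_function_nonneg F \<Longrightarrow> F \<in> borel_measurable borel"
  by (simp add: distribution_function_nonneg_def borel_measurable_mono)

lemma williamson_integrable:
  assumes "distribution_function_nonneg F" "\<alpha> > 0"
  shows "integrable (interval_measure F) (\<lambda>t. indicator {0..x} t * (1 - (t / x) powr \<alpha>))"
proof -
  interpret real_distribution "interval_measure F"
    by (rule real_distribution_interval_measure_nonneg[OF assms(1)])
  show ?thesis
  proof (rule integrable_const_bound[where B = 1])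
    have "(t / x) powr \<alpha> \<le> 1" if "0 \<le> t" "t \<le> x" for t
      using that assms(2) by (intro powr_le1) (auto simp: divide_le_eq_1)
    then show "AE t in interval_measure F. norm (indicator {0..x} t * (1 - (t / x) powr \<alpha>)) \<le> 1"
      by (intro AE_I2) (auto simp: indicator_def)
  qed simp
qed

lemma williamson_nonneg:
  assumes "\<alpha> > 0"
  shows "0 \<le> williamson_transform \<alpha> F x"
proof -
  have "(t / x) powr \<alpha> \<le> 1" if "0 \<le> t" "t \<le> x" for t
    using that assms by (intro powr_le1) (auto simp: divide_le_eq_1)
  then show ?thesis
    unfolding williamson_transform_def set_lebesgue_integral_def
    by (intro integral_nonneg_AE AE_I2) (auto simp: indicator_def)
qed

lemma williamson_le:
  assumes "distribution_function_nonneg F" "\<alpha> > 0"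
  shows "williamson_transform \<alpha> F x \<le> F x"
proof -
  interpret real_distribution "interval_measure F"
    by (rule real_distribution_interval_measure_nonneg[OF assms(1)])
  have "integrable (interval_measure F) (indicator {0..x} :: real \<Rightarrow> real)"
    by (rule integrable_const_bound[where B = 1]) (auto split: split_indicator)
  then have "williamson_transform \<alpha> F x \<le> (\<integral>t. indicator {0..x} t \<partial>interval_measure F)"
    unfolding williamson_transform_def set_lebesgue_integral_def
    using williamson_integrable[OF assms, of x]
    by (intro integral_mono) (auto split: split_indicator)
  then show ?thesis using measure_interval_measure_nonneg[OF assms(1)] by simp
qed

text \<open>The integrand \<open>1 - (t/x)\<^sup>\<alpha>\<close> on \<open>{0..x}\<close> grows pointwise with \<open>x\<close>.\<close>

lemma williamson_mono:
  assumes "distribution_function_nonneg F" "\<alpha> > 0" "x \<le> y"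
  shows "williamson_transform \<alpha> F x \<le> williamson_transform \<alpha> F y"
  unfolding williamson_transform_def set_lebesgue_integral_def real_scaleR_def
proof (intro integral_mono williamson_integrable assms)
  fix t :: real
  have "(t / y) powr \<alpha> \<le> (t / x) powr \<alpha>" if "0 \<le> t" "t \<le> x" "x > 0"
    using that assms by (intro powr_mono2) (auto intro!: divide_left_mono)
  moreover have "(t / y) powr \<alpha> \<le> 1" if "0 \<le> t" "t \<le> y"
    using that assms by (intro powr_le1) (auto simp: divide_le_eq_1)
  ultimately show "indicator {0..x} t * (1 - (t / x) powr \<alpha>) \<le> indicator {0..y} t * (1 - (t / y) powr \<alpha>)"
    using assms by (cases "x = 0") (auto simp: indicator_def)
qed

text \<open>At \<open>x = 0\<close> both sides are the atom of \<open>F\<close> at \<open>0\<close>; hence identities between transforms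
  extend from the positive half-line to all arguments.\<close>

lemma williamson_nonpos:
  assumes "distribution_function_nonneg F" "x \<le> 0"
  shows "williamson_transform \<alpha> F x = F x"
proof (cases "x = 0")
  case True
  have "williamson_transform \<alpha> F x = (\<integral>t. indicator {0..x} t \<partial>interval_measure F)"
    unfolding williamson_transform_def set_lebesgue_integral_def True by simp
  then show ?thesis using measure_interval_measure_nonneg[OF assms(1)] by simp
next
  case False
  with assms show ?thesis
    by (simp add: williamson_transform_def set_lebesgue_integral_def distribution_function_nonneg_def)
qed

lemma williamson_tendsto_1:
  assumes "distribution_function_nonneg F" "\<alpha> > 0"
  shows "(williamson_transform \<alpha> F \<longlongrightarrow> 1) at_top"
proof -
  interpret real_distribution "interval_measure F"
    by (rule real_distribution_interval_measure_nonneg[OF assms(1)])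
  have "((\<lambda>x. \<integral>t. indicator {0..x} t * (1 - (t / x) powr \<alpha>) \<partial>interval_measure F)
      \<longlongrightarrow> (\<integral>t. indicator {0..} t \<partial>interval_measure F)) at_top"
  proof (rule integral_dominated_convergence_at_top[where w = "\<lambda>_. 1"])
    have "((\<lambda>x. indicator {0..x} t * (1 - (t / x) powr \<alpha>)) \<longlongrightarrow> indicator {0..} t) at_top" for t :: real
    proof (cases "t \<ge> 0")
      case True
      have "((\<lambda>x. t / x) \<longlongrightarrow> 0) at_top"
        by (rule tendsto_divide_0[OF tendsto_const]) (rule filterlim_at_top_imp_at_infinity[OF filterlim_ident])
      then have "((\<lambda>x. (t / x) powr \<alpha>) \<longlongrightarrow> 0 powr \<alpha>) at_top"
        using True assms(2)
        by (intro tendsto_powr') (auto intro!: eventually_mono[OF eventually_ge_at_top[of 0]])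
      then have "((\<lambda>x. 1 - (t / x) powr \<alpha>) \<longlongrightarrow> 1 - 0) at_top"
        by (intro tendsto_diff) auto
      then show ?thesis
        by (rule Lim_transform_eventually[OF tendsto_eq_rhs])
           (use True in \<open>auto simp: indicator_def intro!: eventually_mono[OF eventually_ge_at_top[of t]]\<close>)
    qed (auto simp: indicator_def)
    then show "AE t in interval_measure F.
        ((\<lambda>x. indicator {0..x} t * (1 - (t / x) powr \<alpha>)) \<longlongrightarrow> indicator {0..} t) at_top" by simp
    have "(t / x) powr \<alpha> \<le> 1" if "0 \<le> t" "t \<le> x" for t x
      using that assms(2) by (intro powr_le1) (auto simp: divide_le_eq_1)
    then show "\<forall>\<^sub>F x in at_top. AE t in interval_measure F.
        norm (indicator {0..x} t * (1 - (t / x) powr \<alpha>)) \<le> 1"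
      by (intro always_eventually allI AE_I2) (auto simp: indicator_def)
  qed auto
  moreover have "(\<integral>t. indicator {0..} t \<partial>interval_measure F) = (1::real)"
  proof -
    have "(\<lambda>n. measure (interval_measure F) {0..real n}) \<longlonglongrightarrow> measure (interval_measure F) (\<Union>n. {0..real n})"
      by (rule finite_Lim_measure_incseq) (auto simp: incseq_def)
    moreover have "(\<Union>n. {0..real n}) = {0..}" by (auto intro: real_arch_simple)
    moreover have "(\<lambda>n. F (real n)) \<longlonglongrightarrow> 1"
      using assms(1) by (auto simp: distribution_function_nonneg_def
        intro: filterlim_compose[OF _ filterlim_real_sequentially])
    ultimately show ?thesis
      by (simp add: measure_interval_measure_nonneg[OF assms(1)] LIMSEQ_unique)
  qed
  ultimately show ?thesis
    by (simp add: williamson_transform_def[abs_def] set_lebesgue_integral_def)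
qed

text \<open>Behind this formula lies the layer-cake exchange of integrals. It says that \<open>x\<^sup>\<alpha> G(x)\<close> is a primitive of
  \<open>\<alpha> x\<^sup>\<alpha>\<^sup>-\<^sup>1 F(x)\<close>. It determines \<open>F\<close> from its transform \<open>G\<close>, gives the derivative of \<open>G\<close>, and
  lets the transform of an explicitly given distribution function be recognised by differentiation.\<close>

lemma williamson_has_integral:
  assumes F: "distribution_function_nonneg F" and "\<alpha> > 0" "x \<ge> 0"
  shows "((\<lambda>s. \<alpha> * s powr (\<alpha> - 1) * F s) has_integral x powr \<alpha> * williamson_transform \<alpha> F x) {0..x}"
proof -
  interpret real_distribution "interval_measure F"
    by (rule real_distribution_interval_measure_nonneg[OF F])
  note [measurable] = distribution_function_nonneg_borel[OF F]
  note bd = distribution_function_nonneg_bounds[OF F]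
  let ?G = "williamson_transform \<alpha> F x"
  have "(\<integral>\<^sup>+s. ennreal (indicator {0..x} s * (\<alpha> * s powr (\<alpha> - 1) * F s)) \<partial>lborel)
      = (\<integral>\<^sup>+s. ennreal (\<alpha> * s powr (\<alpha> - 1)) * emeasure (interval_measure F) {0..s} * indicator {0..x} s \<partial>lborel)"
    using assms bd by (intro nn_integral_cong)
       (auto simp: emeasure_eq_measure measure_interval_measure_nonneg ennreal_mult' indicator_def)
  also have "\<dots> = (\<integral>\<^sup>+t. ennreal (x powr \<alpha> - t powr \<alpha>) * indicator {0..x} t \<partial>interval_measure F)"
    using assms by (intro nn_integral_layer_cake_below[symmetric] sigma_finite_measure_axioms) auto
  also have "\<dots> = (\<integral>\<^sup>+t. ennreal (x powr \<alpha> * (indicator {0..x} t * (1 - (t / x) powr \<alpha>))) \<partial>interval_measure F)"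
    using assms by (intro nn_integral_cong) (auto simp: indicator_def powr_divide algebra_simps)
  also have "\<dots> = ennreal (\<integral>t. x powr \<alpha> * (indicator {0..x} t * (1 - (t / x) powr \<alpha>)) \<partial>interval_measure F)"
  proof (rule nn_integral_eq_integral)
    show "integrable (interval_measure F) (\<lambda>t. x powr \<alpha> * (indicator {0..x} t * (1 - (t / x) powr \<alpha>)))"
      using williamson_integrable[OF F \<open>\<alpha> > 0\<close>, of x] by auto
    have "(t / x) powr \<alpha> \<le> 1" if "0 \<le> t" "t \<le> x" for t
      using that assms by (intro powr_le1) (auto simp: divide_le_eq_1)
    then show "AE t in interval_measure F. 0 \<le> x powr \<alpha> * (indicator {0..x} t * (1 - (t / x) powr \<alpha>))"
      by (intro AE_I2) (auto simp: indicator_def)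
  qed
  also have "(\<integral>t. x powr \<alpha> * (indicator {0..x} t * (1 - (t / x) powr \<alpha>)) \<partial>interval_measure F) = x powr \<alpha> * ?G"
    by (simp add: williamson_transform_def set_lebesgue_integral_def)
  finally have nn: "(\<integral>\<^sup>+s. ennreal (indicator {0..x} s * (\<alpha> * s powr (\<alpha> - 1) * F s)) \<partial>lborel)
      = ennreal (x powr \<alpha> * ?G)" .
  have "has_bochner_integral lborel (\<lambda>s. indicator {0..x} s * (\<alpha> * s powr (\<alpha> - 1) * F s)) (x powr \<alpha> * ?G)"
    using assms bd nn williamson_nonneg
    by (intro has_bochner_integral_nn_integral) (auto simp: indicator_def)
  then have "((\<lambda>s. indicator {0..x} s * (\<alpha> * s powr (\<alpha> - 1) * F s)) has_integral x powr \<alpha> * ?G) UNIV"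
    by (metis has_integral_integral_lborel has_bochner_integral_iff)
  moreover have "indicator {0..x} s * (\<alpha> * s powr (\<alpha> - 1) * F s)
      = (if s \<in> {0..x} then \<alpha> * s powr (\<alpha> - 1) * F s else 0)" for s
    by simp
  ultimately show ?thesis
    by (simp only: has_integral_restrict_UNIV)
qed

lemma continuous_on_nonneg_imp_isCont:
  assumes "continuous_on {0..} (F :: real \<Rightarrow> real)" "x > 0"
  shows "isCont F x"
proof -
  have "continuous_on {0<..} F" using assms(1) by (rule continuous_on_subset) auto
  with assms(2) show ?thesis by (simp add: continuous_on_eq_continuous_at)
qed

text \<open>Uniqueness in the definition of the Kendall convolution. Distribution functions may jump and are only
  right-continuous, so the primitive is differentiated from the right.\<close>

lemma distribution_function_eqI_williamson:
  assumes F1: "distribution_function_nonneg F1" and F2: "distribution_function_nonneg F2"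
    and "\<alpha> > 0"
    and eq: "\<And>x. x > 0 \<Longrightarrow> williamson_transform \<alpha> F1 x = williamson_transform \<alpha> F2 x"
  shows "F1 = F2"
proof -
  define h where "h = (\<lambda>s. \<alpha> * s powr (\<alpha> - 1) * F1 s - \<alpha> * s powr (\<alpha> - 1) * F2 s)"
  have h0: "(h has_integral 0) {0..y}" if "y \<ge> 0" for y
  proof -
    have "(h has_integral y powr \<alpha> * williamson_transform \<alpha> F1 y - y powr \<alpha> * williamson_transform \<alpha> F2 y) {0..y}"
      unfolding h_def by (intro has_integral_diff williamson_has_integral assms that)
    then show ?thesis using eq[of y] that by (cases "y = 0") auto
  qed
  have pos: "F1 x = F2 x" if "x > 0" for x
  proof -
    have int: "h integrable_on {x..x+1}"
      using that by (intro integrable_subinterval_real[OF has_integral_integrable[OF h0[of "x+1"]]]) auto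
    have z: "integral {x..y} h = 0" if "y \<in> {x..x+1}" for y
    proof -
      have "0 \<le> x" "x \<le> y" "0 \<le> y" using that \<open>x > 0\<close> by auto
      from Henstock_Kurzweil_Integration.integral_combine[OF this(1,2) has_integral_integrable[OF h0[OF this(3)]]]
        integral_unique[OF h0[OF this(1)]] integral_unique[OF h0[OF this(3)]]
      show ?thesis by simp
    qed
    have "continuous (at_right x) h"
      unfolding h_def using F1 F2 that
      by (intro continuous_intros) (auto simp: distribution_function_nonneg_def)
    then have "continuous (at x within ({x..x+1} - {})) h"
      by (simp add: at_within_Icc_at_right)
    with int have "((\<lambda>u. integral {x..u} h) has_vector_derivative h x) (at x within ({x..x+1} - {}))"
      by (intro integral_has_vector_derivative_continuous_at) auto
    then have "((\<lambda>u. 0) has_vector_derivative h x) (at x within {x..x+1})"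
      using z by (intro has_vector_derivative_transform[of x "{x..x+1}" "\<lambda>u. 0" "\<lambda>u. integral {x..u} h"]) auto
    then have "h x = 0"
      by (intro vector_derivative_unique_within[OF _ _ has_vector_derivative_const, of x "{x..x+1}"])
         (auto simp: at_within_Icc_at_right)
    with that \<open>\<alpha> > 0\<close> show ?thesis by (simp add: h_def)
  qed
  have "F1 0 = F2 0"
  proof (rule tendsto_unique)
    show "(F1 \<longlongrightarrow> F1 0) (at_right 0)" "(F1 \<longlongrightarrow> F2 0) (at_right 0)"
    proof -
      show "(F1 \<longlongrightarrow> F1 0) (at_right 0)"
        using F1 by (auto simp: distribution_function_nonneg_def continuous_within)
      have "(F2 \<longlongrightarrow> F2 0) (at_right 0)"
        using F2 by (auto simp: distribution_function_nonneg_def continuous_within)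
      then show "(F1 \<longlongrightarrow> F2 0) (at_right 0)"
        by (rule Lim_transform_eventually) (auto simp: eventually_at_filter pos)
    qed
  qed simp
  show ?thesis
  proof
    fix x :: real
    consider "x < 0" | "x = 0" | "x > 0" by linarith
    then show "F1 x = F2 x"
      by cases (use F1 F2 pos \<open>F1 0 = F2 0\<close> in \<open>auto simp: distribution_function_nonneg_def\<close>)
  qed
qed

text \<open>Differentiate \<open>G(x) = x\<^sup>-\<^sup>\<alpha> \<integral>\<^sub>0\<^sup>x \<alpha> s\<^sup>\<alpha>\<^sup>-\<^sup>1 F(s) ds\<close>.\<close>

lemma williamson_has_derivative:
  assumes F: "distribution_function_nonneg F" and cont: "isCont F x" and "\<alpha> > 0" "x > 0"
  shows "(williamson_transform \<alpha> F has_real_derivative \<alpha> * (F x - williamson_transform \<alpha> F x) / x) (at x)"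
proof -
  define h where "h = (\<lambda>s. \<alpha> * s powr (\<alpha> - 1) * F s)"
  have hi: "(h has_integral y powr \<alpha> * williamson_transform \<alpha> F y) {0..y}" if "y \<ge> 0" for y
    unfolding h_def by (intro williamson_has_integral assms that)
  have "isCont h x"
    unfolding h_def using cont \<open>x > 0\<close> by (intro continuous_intros) auto
  then have "continuous (at x within ({0..x+1} - {})) h"
    by (rule continuous_at_imp_continuous_at_within)
  then have "((\<lambda>u. integral {0..u} h) has_vector_derivative h x) (at x within ({0..x+1} - {}))"
    using \<open>x > 0\<close>
    by (intro integral_has_vector_derivative_continuous_at has_integral_integrable[OF hi]) auto
  moreover have "at x within ({0..x+1} - {}) = at x"
    using \<open>x > 0\<close> by (simp add: at_within_Icc_at)
  ultimately have "((\<lambda>u. integral {0..u} h) has_real_derivative h x) (at x)"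
    by (simp add: has_real_derivative_iff_has_vector_derivative)
  then have "((\<lambda>u. integral {0..u} h * u powr (- \<alpha>)) has_real_derivative
      h x * x powr (- \<alpha>) + integral {0..x} h * (- \<alpha> * x powr (- \<alpha> - 1))) (at x)"
    using \<open>x > 0\<close> by (auto intro!: derivative_eq_intros)
  moreover have "h x * x powr (- \<alpha>) + integral {0..x} h * (- \<alpha> * x powr (- \<alpha> - 1))
      = \<alpha> * (F x - williamson_transform \<alpha> F x) / x"
  proof -
    have 1: "x powr (\<alpha> - 1) * x powr (- \<alpha>) = 1 / x" "x powr \<alpha> * x powr (- \<alpha> - 1) = 1 / x"
      using \<open>x > 0\<close> by (simp_all add: powr_diff powr_minus field_simps)
    have "integral {0..x} h = x powr \<alpha> * williamson_transform \<alpha> F x"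
      using hi[of x] \<open>x > 0\<close> by (simp add: has_integral_iff)
    then have "h x * x powr (- \<alpha>) + integral {0..x} h * (- \<alpha> * x powr (- \<alpha> - 1))
      = \<alpha> * F x * (x powr (\<alpha> - 1) * x powr (- \<alpha>))
        - \<alpha> * williamson_transform \<alpha> F x * (x powr \<alpha> * x powr (- \<alpha> - 1))"
      by (simp add: h_def algebra_simps)
    then show ?thesis unfolding 1 using \<open>x > 0\<close> by (simp add: field_simps)
  qed
  moreover have "\<forall>\<^sub>F u in nhds x. integral {0..u} h * u powr (- \<alpha>) = williamson_transform \<alpha> F u"
  proof (rule eventually_mono)
    show "\<forall>\<^sub>F u in nhds x. u \<in> {0<..}"
      using \<open>x > 0\<close> by (intro eventually_nhds_in_open) auto
    show "integral {0..u} h * u powr (- \<alpha>) = williamson_transform \<alpha> F u" if "u \<in> {0<..}" for u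
      using hi[of u] that by (simp add: has_integral_iff powr_minus)
  qed
  ultimately show ?thesis
    by (simp add: DERIV_cong_ev)
qed

text \<open>At the endpoint \<open>0\<close> the transform is squeezed between the constant \<open>F(0)\<close> and \<open>F\<close>.\<close>

lemma williamson_continuous_on:
  assumes F: "distribution_function_nonneg F" and cont: "continuous_on {0..} F" and "\<alpha> > 0"
  shows "continuous_on {0..} (williamson_transform \<alpha> F)"
  unfolding continuous_on_def
proof
  fix x :: real assume "x \<in> {0..}"
  let ?G = "williamson_transform \<alpha> F"
  show "(?G \<longlongrightarrow> ?G x) (at x within {0..})"
  proof (cases "x = 0")
    case True
    have "(F \<longlongrightarrow> F 0) (at 0 within {0..})"
      using cont by (auto simp: continuous_on_def)
    moreover have "?G 0 = F 0" using williamson_nonpos[OF F, of 0] by simp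
    ultimately have "(?G \<longlongrightarrow> F 0) (at 0 within {0..})"
      using williamson_mono[OF F \<open>\<alpha> > 0\<close>, of 0] williamson_le[OF F \<open>\<alpha> > 0\<close>]
      by (intro tendsto_sandwich[of "\<lambda>_. F 0" ?G _ F]) (auto simp: eventually_at_filter)
    then show ?thesis using True \<open>?G 0 = F 0\<close> by simp
  next
    case False
    with \<open>x \<in> {0..}\<close> have "x > 0" by auto
    then have "isCont ?G x"
      using williamson_has_derivative[OF F continuous_on_nonneg_imp_isCont[OF cont] \<open>\<alpha> > 0\<close>]
      by (auto intro: DERIV_isCont)
    then show ?thesis
      by (simp add: continuous_at_imp_continuous_at_within flip: continuous_within)
  qed
qed

section \<open>The Kendall convolution in closed form\<close>

text \<open>Inverting the transform amounts to \<open>F = G + x G' / \<alpha>\<close>. Applied to the product of two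
  transforms this gives \<open>F\<^sub>1 G\<^sub>2 + G\<^sub>1 F\<^sub>2 - G\<^sub>1 G\<^sub>2\<close>, the function \<open>H\<close> below. The lemmas of this context
  verify that it is a distribution function with the required transform.\<close>

context
  fixes \<alpha> :: real and F1 F2 H G1 G2 :: "real \<Rightarrow> real"
  assumes F1: "distribution_function_nonneg F1" "continuous_on {0..} F1"
    and F2: "distribution_function_nonneg F2" "continuous_on {0..} F2"
    and \<alpha>: "\<alpha> > 0"
  defines "G1 \<equiv> williamson_transform \<alpha> F1" and "G2 \<equiv> williamson_transform \<alpha> F2"
    and "H \<equiv> \<lambda>x. F1 x * G2 x + G1 x * F2 x - G1 x * G2 x"
begin

lemma kendall_product_continuous_on: "continuous_on {0..} H"
  unfolding H_def G1_def G2_def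
  by (intro continuous_intros williamson_continuous_on F1 F2 \<alpha>)

lemma kendall_product_distribution_function: "distribution_function_nonneg H"
  unfolding distribution_function_nonneg_def
proof (intro conjI allI impI)
  have F_mono: "F1 x \<le> F1 y" "F2 x \<le> F2 y" if "x \<le> y" for x y
    using F1 F2 that by (auto simp: distribution_function_nonneg_def mono_def)
  have G_mono: "G1 x \<le> G1 y" "G2 x \<le> G2 y" if "x \<le> y" for x y
    unfolding G1_def G2_def by (intro williamson_mono F1 F2 \<alpha> that)+
  have G_nonneg: "0 \<le> G1 x" "0 \<le> G2 x" for x
    unfolding G1_def G2_def by (intro williamson_nonneg \<alpha>)+
  have G_le: "G1 x \<le> F1 x" "G2 x \<le> F2 x" for x
    unfolding G1_def G2_def by (intro williamson_le F1 F2 \<alpha>)+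
  show "mono H"
  proof
    fix x y :: real assume xy: "x \<le> y"
    \<comment> \<open>\<open>H\<close> is increasing in each of \<open>F1\<close>, \<open>F2\<close>, and, as \<open>0 \<le> G \<le> F\<close>, also in each of \<open>G1\<close>, \<open>G2\<close>.\<close>
    have "H x \<le> F1 y * G2 x + G1 x * F2 y - G1 x * G2 x"
      unfolding H_def
      by (intro diff_right_mono add_mono mult_right_mono mult_left_mono F_mono xy G_nonneg)
    also have "\<dots> \<le> H y"
    proof -
      have "0 \<le> (F1 y - G1 y) * (G2 y - G2 x)" "0 \<le> (F2 y - G2 x) * (G1 y - G1 x)"
        using G_le(1)[of y] G_mono[OF xy] G_le(2)[of y]
        by (auto intro!: mult_nonneg_nonneg)
      moreover have "H y - (F1 y * G2 x + G1 x * F2 y - G1 x * G2 x)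
          = (F1 y - G1 y) * (G2 y - G2 x) + (F2 y - G2 x) * (G1 y - G1 x)"
        by (simp add: H_def algebra_simps)
      ultimately show ?thesis by linarith
    qed
    finally show "H x \<le> H y" .
  qed
  show zero: "H x = 0" if "x < 0" for x
    using that F1(1) F2(1) williamson_nonpos[OF F1(1), of x] williamson_nonpos[OF F2(1), of x]
    by (simp add: H_def G1_def G2_def distribution_function_nonneg_def)
  show "continuous (at_right x) H" for x
  proof (cases "x < 0")
    case True
    have "\<forall>\<^sub>F y in nhds x. H y = 0"
      using eventually_nhds_in_open[of "{..<0}" x] True
      by (auto elim!: eventually_mono simp: zero)
    then have "isCont H x"
      by (simp add: isCont_cong)
    then show ?thesis by (rule continuous_at_imp_continuous_at_within)
  next
    case False
    with kendall_product_continuous_on have "continuous (at x within {0..}) H"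
      by (simp add: continuous_on_eq_continuous_within)
    then show ?thesis
      by (rule continuous_within_subset) (use False in auto)
  qed
  have "((\<lambda>x. F1 x * G2 x + G1 x * F2 x - G1 x * G2 x) \<longlongrightarrow> 1 * 1 + 1 * 1 - 1 * 1) at_top"
    using F1(1) F2(1) unfolding G1_def G2_def
    by (intro tendsto_intros williamson_tendsto_1 \<alpha>) (auto simp: distribution_function_nonneg_def)
  then show "(H \<longlongrightarrow> 1) at_top" by (simp add: H_def)
qed

text \<open>Both \<open>x\<^sup>\<alpha> G\<^sub>1(x) G\<^sub>2(x)\<close>, by the product rule, and \<open>x\<^sup>\<alpha>\<close> times the transform of \<open>H\<close>, by the integral formula, are
  primitives of \<open>\<alpha> x\<^sup>\<alpha>\<^sup>-\<^sup>1 H(x)\<close> that vanish at \<open>0\<close>.\<close>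

lemma kendall_product_williamson: "williamson_transform \<alpha> H x = G1 x * G2 x"
proof (cases "x > 0")
  case False
  then show ?thesis
    using williamson_nonpos[OF kendall_product_distribution_function, of x]
      williamson_nonpos[OF F1(1), of x] williamson_nonpos[OF F2(1), of x]
    by (simp add: H_def G1_def G2_def)
next
  case True
  define Q where "Q = (\<lambda>y. y powr \<alpha> * (G1 y * G2 y))"
  have "(Q has_real_derivative \<alpha> * y powr (\<alpha> - 1) * H y) (at y)" if "y > 0" for y
  proof -
    have d: "(G1 has_real_derivative \<alpha> * (F1 y - G1 y) / y) (at y)"
      "(G2 has_real_derivative \<alpha> * (F2 y - G2 y) / y) (at y)"
      unfolding G1_def G2_def
      by (intro williamson_has_derivative continuous_on_nonneg_imp_isCont F1 F2 \<alpha> that)+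
    have "(Q has_real_derivative \<alpha> * y powr (\<alpha> - 1) * (G1 y * G2 y)
        + (\<alpha> * (F1 y - G1 y) / y * G2 y + \<alpha> * (F2 y - G2 y) / y * G1 y) * y powr \<alpha>) (at y)"
      unfolding Q_def
      by (intro DERIV_mult d has_real_derivative_powr that)
    moreover have "y powr \<alpha> = y * y powr (\<alpha> - 1)"
      using that powr_mult_base[of y "\<alpha> - 1"] by simp
    ultimately show ?thesis
      using that by (elim DERIV_cong) (simp add: H_def field_simps)
  qed
  then have "((\<lambda>s. \<alpha> * s powr (\<alpha> - 1) * H s) has_integral Q x - Q 0) {0..x}"
    using True \<alpha> unfolding Q_def
    by (intro fundamental_theorem_of_calculus_interior continuous_on_mult continuous_on_powr'
        continuous_on_id continuous_on_const)
       (auto simp: G1_def G2_def simp flip: has_real_derivative_iff_has_vector_derivative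
         intro: continuous_on_subset[OF williamson_continuous_on[OF F1]]
           continuous_on_subset[OF williamson_continuous_on[OF F2]])
  moreover have "((\<lambda>s. \<alpha> * s powr (\<alpha> - 1) * H s) has_integral
      x powr \<alpha> * williamson_transform \<alpha> H x) {0..x}"
    using True by (intro williamson_has_integral kendall_product_distribution_function \<alpha>) auto
  ultimately have "x powr \<alpha> * williamson_transform \<alpha> H x = Q x - Q 0"
    by (metis has_integral_unique)
  with True \<alpha> show ?thesis by (simp add: Q_def)
qed

lemma kendall_convolution_eq: "kendall_convolution \<alpha> F1 F2 = H"
  unfolding kendall_convolution_def
proof (rule the_equality)
  show "distribution_function_nonneg H \<and>
    (\<forall>x>0. williamson_transform \<alpha> H x = williamson_transform \<alpha> F1 x * williamson_transform \<alpha> F2 x)"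
    using kendall_product_distribution_function kendall_product_williamson
    by (simp add: G1_def G2_def)
  fix F3
  assume "distribution_function_nonneg F3 \<and>
    (\<forall>x>0. williamson_transform \<alpha> F3 x = williamson_transform \<alpha> F1 x * williamson_transform \<alpha> F2 x)"
  then show "F3 = H"
    using kendall_product_williamson
    by (intro distribution_function_eqI_williamson[OF _ kendall_product_distribution_function \<alpha>])
       (auto simp: G1_def G2_def)
qed

end

section \<open>Kendall powers and the renewal function\<close>

lemma distribution_function_dirac:
  "distribution_function_nonneg (cdf (return borel (0::real)))"
  "x \<ge> 0 \<Longrightarrow> cdf (return borel (0::real)) x = 1"
proof -
  interpret prob_space "return borel (0::real)" by (rule prob_space_return) simp
  interpret real_distribution "return borel (0::real)" by standard simp
  have eq: "cdf (return borel (0::real)) x = (if x \<ge> 0 then 1 else 0)" for x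
    by (simp add: cdf_def2 measure_return indicator_def)
  then show "x \<ge> 0 \<Longrightarrow> cdf (return borel (0::real)) x = 1" by simp
  show "distribution_function_nonneg (cdf (return borel (0::real)))"
    unfolding distribution_function_nonneg_def
    by (intro conjI allI impI cdf_is_right_cont cdf_lim_at_top_prob monoI cdf_nondecreasing)
       (simp_all add: eq)
qed

text \<open>Induction with the closed form of the convolution; the four parts feed each other, since the convolution
  formula needs the previous power to be a distribution function, continuous on \<open>{0..}\<close>, with known
  transform. The value is \<open>G\<^sup>n + x (G\<^sup>n)' / \<alpha>\<close>.\<close>

lemma kendall_power_eq:
  assumes F: "distribution_function_nonneg F" "continuous_on {0..} F" and "\<alpha> > 0"
  defines "G \<equiv> williamson_transform \<alpha> F"
  shows "distribution_function_nonneg (kendall_power \<alpha> F n) \<and>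
    continuous_on {0..} (kendall_power \<alpha> F n) \<and>
    (\<forall>x\<ge>0. williamson_transform \<alpha> (kendall_power \<alpha> F n) x = G x ^ n) \<and>
    (\<forall>x\<ge>0. kendall_power \<alpha> F n x = G x ^ n + real n * G x ^ (n - 1) * (F x - G x))"
proof (induction n)
  case 0
  let ?D = "cdf (return borel (0::real))"
  note D = distribution_function_dirac
  \<comment> \<open>monotonicity squeezes the transform between its value \<open>1\<close> at \<open>0\<close> and \<open>?D x = 1\<close>\<close>
  have "williamson_transform \<alpha> ?D x = 1" if "x \<ge> 0" for x
    using williamson_mono[OF D(1) \<open>\<alpha> > 0\<close> that] williamson_nonpos[OF D(1), of 0]
      williamson_le[OF D(1) \<open>\<alpha> > 0\<close>, of x] D(2)[of 0] D(2)[OF that] by simp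
  moreover have "continuous_on {0..} ?D"
    using continuous_on_const[of "{0..}" 1] D(2) by (subst continuous_on_cong[OF refl, of _ _ "\<lambda>_. 1"]) auto
  ultimately show ?case using D by simp
next
  case (Suc n)
  let ?P = "kendall_power \<alpha> F n"
  let ?H = "\<lambda>x. F x * williamson_transform \<alpha> ?P x + williamson_transform \<alpha> F x * ?P x
    - williamson_transform \<alpha> F x * williamson_transform \<alpha> ?P x"
  have P: "distribution_function_nonneg ?P" "continuous_on {0..} ?P"
    and W: "\<And>x. x \<ge> 0 \<Longrightarrow> williamson_transform \<alpha> ?P x = G x ^ n"
    and V: "\<And>x. x \<ge> 0 \<Longrightarrow> ?P x = G x ^ n + real n * G x ^ (n - 1) * (F x - G x)"
    using Suc.IH by auto
  have eq: "kendall_power \<alpha> F (Suc n) = ?H"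
    using kendall_convolution_eq[OF F P \<open>\<alpha> > 0\<close>] by simp
  have "?H x = G x ^ Suc n + real (Suc n) * G x ^ n * (F x - G x)" if "x \<ge> 0" for x
    unfolding W[OF that] V[OF that] G_def[symmetric]
    by (cases n) (simp_all add: algebra_simps)
  moreover have "williamson_transform \<alpha> ?H x = G x ^ Suc n" if "x \<ge> 0" for x
    using kendall_product_williamson[OF F P \<open>\<alpha> > 0\<close>, of x] W[OF that] by (simp add: G_def)
  ultimately show ?case
    unfolding eq using kendall_product_distribution_function[OF F P \<open>\<alpha> > 0\<close>]
      kendall_product_continuous_on[OF F P \<open>\<alpha> > 0\<close>] by simp
qed

text \<open>The geometric series for \<open>G\<close> and its derivative; convergence holds because \<open>G \<le> F < 1\<close>.\<close>

lemma kendall_renewal_sums: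
  assumes F: "distribution_function_nonneg F" "continuous_on {0..} F" and "\<alpha> > 0"
    and lt: "\<And>x. F x < 1"
  defines "G \<equiv> williamson_transform \<alpha> F"
  shows "summable (\<lambda>n. kendall_power \<alpha> F n x)"
    and "x \<ge> 0 \<Longrightarrow> kendall_renewal \<alpha> F x = 1 / (1 - G x) + (F x - G x) / (1 - G x)\<^sup>2"
proof -
  note P = kendall_power_eq[OF F \<open>\<alpha> > 0\<close>]
  have sums: "(\<lambda>n. kendall_power \<alpha> F n x) sums (1 / (1 - G x) + (F x - G x) / (1 - G x)\<^sup>2)"
    if "x \<ge> 0"
  proof -
    have "G x \<ge> 0" "G x < 1"
      using williamson_nonneg[OF \<open>\<alpha> > 0\<close>, of F x] williamson_le[OF F(1) \<open>\<alpha> > 0\<close>, of x] lt[of x]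
      by (auto simp: G_def)
    then have n: "norm (G x) < 1" by simp
    have "(\<lambda>n. real (Suc n) * G x ^ n) sums (1 / (1 - G x)\<^sup>2)"
      using geometric_deriv_sums[OF n] by simp
    then have "(\<lambda>n. (\<lambda>k. real k * G x ^ (k - 1)) (Suc n)) sums (1 / (1 - G x)\<^sup>2)" by simp
    then have "(\<lambda>k. real k * G x ^ (k - 1)) sums (1 / (1 - G x)\<^sup>2 + real 0 * G x ^ (0 - 1))"
      by (rule sums_Suc)
    then have "(\<lambda>k. real k * G x ^ (k - 1) * (F x - G x)) sums (1 / (1 - G x)\<^sup>2 * (F x - G x))"
      by (intro sums_mult2) simp
    with geometric_sums[OF n]
    have "(\<lambda>k. G x ^ k + real k * G x ^ (k - 1) * (F x - G x)) sums
        (1 / (1 - G x) + 1 / (1 - G x)\<^sup>2 * (F x - G x))"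
      by (rule sums_add)
    then show ?thesis using P that by (simp add: G_def)
  qed
  then show "x \<ge> 0 \<Longrightarrow> kendall_renewal \<alpha> F x = 1 / (1 - G x) + (F x - G x) / (1 - G x)\<^sup>2"
    by (simp add: kendall_renewal_def sums_iff)
  show "summable (\<lambda>n. kendall_power \<alpha> F n x)"
  proof (cases "x \<ge> 0")
    case True
    then show ?thesis using sums by (simp add: sums_iff)
  next
    case False
    with P have "(\<lambda>n. kendall_power \<alpha> F n x) = (\<lambda>n. 0)"
      by (auto simp: distribution_function_nonneg_def)
    then show ?thesis by simp
  qed
qed

text \<open>In the derivative of the closed form the term \<open>G' / (1 - G)\<^sup>2\<close> coming from \<open>1 / (1 - G)\<close> cancels the one
  coming from the numerator \<open>F - G\<close>; what remains of \<open>G' = \<alpha> (F - G) / x\<close> yields the square in the second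
  summand.\<close>

lemma kendall_renewal_has_derivative:
  assumes F: "distribution_function_nonneg F" "continuous_on {0..} F" and "\<alpha> > 0"
    and lt: "\<And>x. F x < 1" and "x > 0" and f: "(F has_real_derivative f) (at x)"
  defines "G \<equiv> williamson_transform \<alpha> F"
  shows "(kendall_renewal \<alpha> F has_real_derivative
    f / (1 - G x)\<^sup>2 + 2 * \<alpha> * (F x - G x)\<^sup>2 / (x * (1 - G x) ^ 3)) (at x)"
proof -
  let ?g = "\<alpha> * (F x - G x) / x"
  have G1: "1 - G x > 0"
    using williamson_le[OF F(1) \<open>\<alpha> > 0\<close>, of x] lt[of x] by (simp add: G_def)
  have dG: "(G has_real_derivative ?g) (at x)"
    unfolding G_def using assms
    by (intro williamson_has_derivative continuous_on_nonneg_imp_isCont) auto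
  have quotient_rule: "(0 * p - 1 * (0 - a)) / (p * p) +
      ((f - a) * p\<^sup>2 - b * (real 2 * ((0 - a) * p ^ (2 - Suc 0)))) / (p\<^sup>2 * p\<^sup>2)
      = f / p\<^sup>2 + 2 * a * b / p ^ 3" if "p > 0" for a b p :: real
    using that by (simp add: divide_simps) (simp add: algebra_simps eval_nat_numeral)
  have "((\<lambda>x. 1 / (1 - G x) + (F x - G x) / (1 - G x)\<^sup>2) has_real_derivative
      f / (1 - G x)\<^sup>2 + 2 * ?g * (F x - G x) / (1 - G x) ^ 3) (at x)"
    by (rule derivative_eq_intros dG f refl quotient_rule[OF G1] | use G1 in force)+
  then have "((\<lambda>x. 1 / (1 - G x) + (F x - G x) / (1 - G x)\<^sup>2) has_real_derivative
      f / (1 - G x)\<^sup>2 + 2 * \<alpha> * (F x - G x)\<^sup>2 / (x * (1 - G x) ^ 3)) (at x)"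
    by (rule DERIV_cong) (simp add: power2_eq_square mult_ac)
  moreover have "\<forall>\<^sub>F y in nhds x. 1 / (1 - G y) + (F y - G y) / (1 - G y)\<^sup>2 = kendall_renewal \<alpha> F y"
  proof (rule eventually_mono)
    show "\<forall>\<^sub>F y in nhds x. y \<in> {0<..}"
      using \<open>x > 0\<close> by (intro eventually_nhds_in_open) auto
  qed (simp add: kendall_renewal_sums[OF F \<open>\<alpha> > 0\<close> lt] G_def)
  ultimately show ?thesis
    by (rule DERIV_cong_ev[OF refl _ refl, THEN iffD1, rotated])
qed

section \<open>Limits of the tail quantities\<close>

text \<open>With \<open>u = x\<^sup>\<alpha> (1 - F)\<close> and \<open>1 - G = x\<^sup>-\<^sup>\<alpha> (m - K)\<close>, this function is the normalised remainder of the
  renewal density. Expanding the square of \<open>(m - K) - u\<close> cancels the singular factor \<open>1 / u\<close>: it is left only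
  in the quotient \<open>K / u\<close>, whose limit is assumed.\<close>

lemma renewal_density_expansion:
  fixes u K b :: "real \<Rightarrow> real" and \<alpha> \<beta> a m :: real
  assumes "(b \<longlongrightarrow> \<beta>) \<F>" "(u \<longlongrightarrow> 0) \<F>" "(K \<longlongrightarrow> 0) \<F>" "((\<lambda>x. K x / u x) \<longlongrightarrow> a) \<F>"
    and "\<forall>\<^sub>F x in \<F>. u x > 0" and "m > 0"
  shows "((\<lambda>x. b x / (m - K x)\<^sup>2 + 2 * \<alpha> * ((m - K x - u x)\<^sup>2 / (m - K x) ^ 3 - 1 / m) / u x)
           \<longlongrightarrow> (\<beta> + 2 * \<alpha> * (a - 2)) / m\<^sup>2) \<F>"
proof -
  have lim: "((\<lambda>x. b x / (m - K x)\<^sup>2 + 2 * \<alpha> *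
      (K x / u x / (m * (m - K x)) - 2 / (m - K x)\<^sup>2 + u x / (m - K x) ^ 3))
      \<longlongrightarrow> \<beta> / (m - 0)\<^sup>2 + 2 * \<alpha> * (a / (m * (m - 0)) - 2 / (m - 0)\<^sup>2 + 0 / (m - 0) ^ 3)) \<F>"
    using assms by (intro tendsto_intros) auto
  have const: "\<beta> / (m - 0)\<^sup>2 + 2 * \<alpha> * (a / (m * (m - 0)) - 2 / (m - 0)\<^sup>2 + 0 / (m - 0) ^ 3)
      = (\<beta> + 2 * \<alpha> * (a - 2)) / m\<^sup>2"
    by (simp add: power2_eq_square add_divide_distrib diff_divide_distrib algebra_simps)
  have ev: "\<forall>\<^sub>F x in \<F>. b x / (m - K x)\<^sup>2 + 2 * \<alpha> *
      (K x / u x / (m * (m - K x)) - 2 / (m - K x)\<^sup>2 + u x / (m - K x) ^ 3)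
      = b x / (m - K x)\<^sup>2 + 2 * \<alpha> * ((m - K x - u x)\<^sup>2 / (m - K x) ^ 3 - 1 / m) / u x"
    using assms(5) order_tendstoD(2)[OF assms(3) \<open>m > 0\<close>]
  proof eventually_elim
    case (elim x)
    have "k / v / (m * (m - k)) - 2 / (m - k)\<^sup>2 + v / (m - k) ^ 3
        = ((m - k - v)\<^sup>2 / (m - k) ^ 3 - 1 / m) / v" if "v > 0" "k < m" for v k
    proof -
      define p where "p = m - k"
      have "k = m - p" "p > 0" using that by (auto simp: p_def)
      then show ?thesis using that \<open>m > 0\<close>
        by (simp add: divide_simps) (simp add: algebra_simps eval_nat_numeral)
    qed
    from this[OF elim(1,2)] show ?case by simp
  qed
  show ?thesis
    using Lim_transform_eventually[OF lim ev] unfolding const .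
qed

text \<open>An elementary substitute for Karamata's theorem: \<open>T = u + K\<close> is an integration by parts, and the
  asymptotic proportionality of \<open>\<alpha> T\<close> to \<open>\<beta> K\<close> turns it into \<open>\<alpha> u \<sim> (\<beta> - \<alpha>) K\<close>.\<close>

lemma tail_ratio_limit:
  fixes u K T :: "real \<Rightarrow> real" and \<alpha> \<beta> :: real
  assumes "\<alpha> > 0" "\<beta> > \<alpha>"
    and T: "\<forall>\<^sub>F x in at_top. T x = u x + K x" and u: "\<forall>\<^sub>F x in at_top. u x > 0"
    and K: "\<forall>\<^sub>F x in at_top. K x \<ge> 0" "(K \<longlongrightarrow> 0) at_top"
    and sq: "\<And>\<epsilon>. \<epsilon> > 0 \<Longrightarrow> \<forall>\<^sub>F x in at_top. (\<beta> - \<epsilon>) * K x \<le> \<alpha> * T x \<and> \<alpha> * T x \<le> (\<beta> + \<epsilon>) * K x"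
  shows "((\<lambda>x. K x / u x) \<longlongrightarrow> \<alpha> / (\<beta> - \<alpha>)) at_top" "(u \<longlongrightarrow> 0) at_top"
proof -
  have K_pos: "\<forall>\<^sub>F x in at_top. K x > 0"
    using T u K(1) sq[OF zero_less_one]
  proof eventually_elim
    case (elim x)
    have "K x \<noteq> 0"
    proof
      assume "K x = 0"
      with elim have "\<alpha> * u x \<le> 0" by simp
      with \<open>\<alpha> > 0\<close> \<open>u x > 0\<close> show False by (simp add: mult_le_0_iff)
    qed
    with elim show ?case by simp
  qed
  have "((\<lambda>x. u x / K x) \<longlongrightarrow> (\<beta> - \<alpha>) / \<alpha>) at_top"
  proof (rule tendstoI)
    fix e :: real assume "e > 0"
    define \<epsilon> where "\<epsilon> = e * \<alpha> / 2"
    have "\<epsilon> > 0" using \<open>e > 0\<close> \<open>\<alpha> > 0\<close> by (simp add: \<epsilon>_def)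
    show "\<forall>\<^sub>F x in at_top. dist (u x / K x) ((\<beta> - \<alpha>) / \<alpha>) < e"
      using T K_pos sq[OF \<open>\<epsilon> > 0\<close>]
    proof eventually_elim
      case (elim x)
      then have "\<bar>\<alpha> * u x - (\<beta> - \<alpha>) * K x\<bar> \<le> \<epsilon> * K x"
        by (simp add: algebra_simps abs_le_iff)
      also have "\<dots> < e * \<alpha> * K x"
        using \<open>e > 0\<close> \<open>\<alpha> > 0\<close> \<open>K x > 0\<close> by (simp add: \<epsilon>_def)
      finally have "\<bar>\<alpha> * u x - (\<beta> - \<alpha>) * K x\<bar> / (\<alpha> * K x) < e"
        using \<open>\<alpha> > 0\<close> \<open>K x > 0\<close> by (simp add: pos_divide_less_eq mult_ac)
      moreover have "u x / K x - (\<beta> - \<alpha>) / \<alpha> = (\<alpha> * u x - (\<beta> - \<alpha>) * K x) / (\<alpha> * K x)"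
        using \<open>\<alpha> > 0\<close> \<open>K x > 0\<close> by (simp add: field_simps)
      ultimately show ?case
        using \<open>\<alpha> > 0\<close> \<open>K x > 0\<close> by (simp add: dist_real_def abs_divide abs_mult)
    qed
  qed
  note lim = this
  then have "((\<lambda>x. inverse (u x / K x)) \<longlongrightarrow> inverse ((\<beta> - \<alpha>) / \<alpha>)) at_top"
    using assms(1,2) by (intro tendsto_inverse) auto
  then show "((\<lambda>x. K x / u x) \<longlongrightarrow> \<alpha> / (\<beta> - \<alpha>)) at_top" by simp
  have "((\<lambda>x. u x / K x * K x) \<longlongrightarrow> (\<beta> - \<alpha>) / \<alpha> * 0) at_top"
    by (intro tendsto_mult lim K)
  then have "((\<lambda>x. u x / K x * K x) \<longlongrightarrow> 0) at_top" by simp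
  then show "(u \<longlongrightarrow> 0) at_top"
    by (rule Lim_transform_eventually) (use K_pos in \<open>auto elim!: eventually_mono\<close>)
qed

section \<open>Tail integrals of a distribution with a density\<close>

text \<open>The quantity \<open>K(x) = \<integral>\<^sub>x\<^sup>\<infinity> \<alpha> s\<^sup>\<alpha>\<^sup>-\<^sup>1 (1 - F(s)) ds\<close> links the transform to the tail: it is the defect of
  \<open>x\<^sup>\<alpha> (1 - G(x))\<close> from its limit, the \<open>\<alpha>\<close>-moment.\<close>

context
  fixes f F K :: "real \<Rightarrow> real" and \<alpha> :: real
  assumes f_meas [measurable]: "f \<in> borel_measurable borel" and f_nonneg: "\<And>t. f t \<ge> 0"
    and prob: "prob_space (density lborel f)"
    and F_cdf: "F = cdf (density lborel f)"
    and \<alpha>: "\<alpha> > 0"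
    and moment: "set_integrable lborel {0..} (\<lambda>t. t powr \<alpha> * f t)"
  defines "K \<equiv> \<lambda>x. LINT s:{x..}|lborel. \<alpha> * s powr (\<alpha> - 1) * (1 - F s)"
begin

lemma density_cdf_real_distribution: "real_distribution (density lborel f)"
  using prob by (simp add: real_distribution_def real_distribution_axioms_def)

lemma density_cdf_singleton: "measure (density lborel f) {x} = 0"
proof -
  have "emeasure (density lborel f) {x} = 0"
    by (subst emeasure_density) (auto simp: nn_integral_0_iff_AE AE_lborel_singleton
        intro!: AE_mp[OF AE_lborel_singleton[of x]] AE_I2)
  then show ?thesis by (simp add: measure_def)
qed

lemma density_cdf_isCont: "isCont F x"
  using finite_borel_measure.isCont_cdf[OF
      real_distribution.finite_borel_measure_M[OF density_cdf_real_distribution]]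
  by (simp add: F_cdf density_cdf_singleton)

lemma density_cdf_le_1: "F x \<le> 1"
  unfolding F_cdf by (rule real_distribution.cdf_bounded_prob[OF density_cdf_real_distribution])

lemma density_cdf_borel: "F \<in> borel_measurable borel"
  by (intro borel_measurable_continuous_onI continuous_at_imp_continuous_on ballI density_cdf_isCont)

lemma density_cdf_tail: "emeasure (density lborel f) {s..} = ennreal (1 - F s)"
proof -
  interpret real_distribution "density lborel f" by (rule density_cdf_real_distribution)
  have "{..s} = {..<s} \<union> {s}" by auto
  then have "measure (density lborel f) {..s} = measure (density lborel f) {..<s} + measure (density lborel f) {s}"
    by (simp only:) (rule finite_measure_Union, auto)
  then have "measure (density lborel f) {..<s} = F s"
    by (simp add: density_cdf_singleton F_cdf cdf_def2)
  moreover have "measure (density lborel f) (UNIV - {..<s}) = 1 - measure (density lborel f) {..<s}"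
    using prob_compl[of "{..<s}"] by simp
  moreover have "UNIV - {..<s} = {s..}" by auto
  ultimately show ?thesis by (simp add: emeasure_eq_measure)
qed

lemma moment_set_integrable: "x \<ge> 0 \<Longrightarrow> set_integrable lborel {x..} (\<lambda>t. t powr \<alpha> * f t)"
  by (rule set_integrable_subset[OF moment]) auto

lemma density_set_integral_tail:
  "set_integrable lborel {x..} f" "(LINT t:{x..}|lborel. f t) = 1 - F x"
proof -
  have "(\<integral>\<^sup>+t. ennreal (indicator {x..} t * f t) \<partial>lborel) = emeasure (density lborel f) {x..}"
    by (subst emeasure_density) (auto intro!: nn_integral_cong simp: indicator_def)
  then have "has_bochner_integral lborel (\<lambda>t. indicator {x..} t * f t) (1 - F x)"
    using density_cdf_le_1[of x] f_nonneg
    by (intro has_bochner_integral_nn_integral) (auto simp: density_cdf_tail)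
  then show "set_integrable lborel {x..} f" "(LINT t:{x..}|lborel. f t) = 1 - F x"
    by (simp_all add: set_integrable_def set_lebesgue_integral_def has_bochner_integral_iff)
qed

text \<open>Integration by parts of the tail moment, obtained from the layer-cake formula so that no
  boundary term at infinity has to be controlled.\<close>

lemma tail_moment_decomposition:
  assumes "x \<ge> 0"
  shows "set_integrable lborel {x..} (\<lambda>s. \<alpha> * s powr (\<alpha> - 1) * (1 - F s))"
    and "(LINT t:{x..}|lborel. t powr \<alpha> * f t) = x powr \<alpha> * (1 - F x) + K x"
proof -
  note [measurable] = density_cdf_borel
  interpret real_distribution "density lborel f" by (rule density_cdf_real_distribution)
  let ?D = "(LINT t:{x..}|lborel. t powr \<alpha> * f t) - x powr \<alpha> * (1 - F x)"
  let ?h = "\<lambda>t. indicator {x..} t * ((t powr \<alpha> - x powr \<alpha>) * f t)"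
  have int: "set_integrable lborel {x..} (\<lambda>t. t powr \<alpha> * f t - x powr \<alpha> * f t)"
    using moment_set_integrable[OF assms] density_set_integral_tail(1)[of x] by (intro set_integral_diff) auto
  have D: "(LINT t:{x..}|lborel. t powr \<alpha> * f t - x powr \<alpha> * f t) = ?D"
    using moment_set_integrable[OF assms] density_set_integral_tail[of x] by (subst set_integral_diff) auto
  have h_nonneg: "0 \<le> ?h t" for t
    using assms \<alpha> f_nonneg[of t] by (auto simp: indicator_def intro!: mult_nonneg_nonneg powr_mono2)
  have "(\<integral>\<^sup>+s. ennreal (indicator {x..} s * (\<alpha> * s powr (\<alpha> - 1) * (1 - F s))) \<partial>lborel)
      = (\<integral>\<^sup>+s. ennreal (\<alpha> * s powr (\<alpha> - 1)) * emeasure (density lborel f) {s..} * indicator {x..} s \<partial>lborel)"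
    using \<alpha> by (intro nn_integral_cong) (auto simp: density_cdf_tail ennreal_mult' indicator_def)
  also have "\<dots> = (\<integral>\<^sup>+t. ennreal (t powr \<alpha> - x powr \<alpha>) * indicator {x..} t \<partial>density lborel f)"
    using assms \<alpha> by (intro nn_integral_layer_cake_above[symmetric] sigma_finite_measure_axioms) auto
  also have "\<dots> = (\<integral>\<^sup>+t. ennreal (?h t) \<partial>lborel)"
    using f_nonneg
    by (subst nn_integral_density) (auto intro!: nn_integral_cong simp: indicator_def ennreal_mult' ennreal_mult'' mult_ac)
  also have "\<dots> = ennreal (\<integral>t. ?h t \<partial>lborel)"
    using int h_nonneg
    by (intro nn_integral_eq_integral) (auto simp: set_integrable_def algebra_simps)
  also have "(\<integral>t. ?h t \<partial>lborel) = ?D"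
    unfolding D[symmetric] by (simp add: set_lebesgue_integral_def algebra_simps)
  finally have nn: "(\<integral>\<^sup>+s. ennreal (indicator {x..} s * (\<alpha> * s powr (\<alpha> - 1) * (1 - F s))) \<partial>lborel) = ennreal ?D" .
  have "0 \<le> (\<integral>t. ?h t \<partial>lborel)" using h_nonneg by (intro integral_nonneg_AE) auto
  then have "0 \<le> ?D" unfolding D[symmetric] by (simp add: set_lebesgue_integral_def algebra_simps)
  with nn have "has_bochner_integral lborel (\<lambda>s. indicator {x..} s * (\<alpha> * s powr (\<alpha> - 1) * (1 - F s))) ?D"
    using \<alpha> density_cdf_le_1
    by (intro has_bochner_integral_nn_integral) (auto simp: indicator_def)
  then show "set_integrable lborel {x..} (\<lambda>s. \<alpha> * s powr (\<alpha> - 1) * (1 - F s))"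
    "(LINT t:{x..}|lborel. t powr \<alpha> * f t) = x powr \<alpha> * (1 - F x) + K x"
    by (simp_all add: K_def set_integrable_def set_lebesgue_integral_def has_bochner_integral_iff)
qed

lemma tail_integral_nonneg: "0 \<le> K x"
  unfolding K_def set_lebesgue_integral_def using \<alpha> density_cdf_le_1
  by (intro integral_nonneg_AE) (auto simp: indicator_def)

lemma tail_integral_tendsto_0: "(K \<longlongrightarrow> 0) at_top"
proof -
  note [measurable] = density_cdf_borel
  let ?g = "\<lambda>s. \<alpha> * s powr (\<alpha> - 1) * (1 - F s)"
  have "((\<lambda>x. \<integral>s. indicator {x..} s * ?g s \<partial>lborel) \<longlongrightarrow> (\<integral>s. 0 \<partial>(lborel :: real measure))) at_top"
  proof (rule integral_dominated_convergence_at_top[where w = "\<lambda>s. indicator {0..} s * ?g s"])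
    show "integrable lborel (\<lambda>s. indicator {0..} s * ?g s)"
      using tail_moment_decomposition(1)[of 0] by (simp add: set_integrable_def)
    show "\<forall>\<^sub>F x in at_top. AE s in lborel. norm (indicator {x..} s * ?g s) \<le> indicator {0..} s * ?g s"
      using eventually_ge_at_top[of 0]
      by eventually_elim (use \<alpha> density_cdf_le_1 in \<open>auto simp: indicator_def abs_mult\<close>)
    have "((\<lambda>x. indicator {x..} s * ?g s) \<longlongrightarrow> 0) at_top" for s
      by (intro tendsto_eventually eventually_mono[OF eventually_gt_at_top[of s]]) (auto simp: indicator_def)
    then show "AE s in lborel. ((\<lambda>x. indicator {x..} s * ?g s) \<longlongrightarrow> 0) at_top" by simp
  qed auto
  then show ?thesis by (simp add: K_def[abs_def] set_lebesgue_integral_def)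
qed

text \<open>By the integral formula, \<open>x\<^sup>\<alpha> (1 - G(x))\<close> is the integral of \<open>\<alpha> s\<^sup>\<alpha>\<^sup>-\<^sup>1 (1 - F(s))\<close> over \<open>{0..x}\<close>, and
  over the whole half-line that integral is the moment.\<close>

lemma tail_integral_eq_williamson:
  assumes "x \<ge> 0" and F: "distribution_function_nonneg F"
  shows "K x = (LINT t:{0..}|lborel. t powr \<alpha> * f t) - x powr \<alpha> * (1 - williamson_transform \<alpha> F x)"
proof -
  note [measurable] = density_cdf_borel
  let ?g = "\<lambda>s. \<alpha> * s powr (\<alpha> - 1) * (1 - F s)"
  note int0 = tail_moment_decomposition(1)[of 0, simplified]
  have int: "set_integrable lborel {0..<x} ?g" "set_integrable lborel {0..x} ?g"
    by (rule set_integrable_subset[OF int0]; auto)+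
  have "{0..} = {0..<x} \<union> {x..}" using assms by auto
  then have "K 0 = (LINT s:{0..<x} \<union> {x..}|lborel. ?g s)" by (simp add: K_def)
  also have "\<dots> = (LINT s:{0..<x}|lborel. ?g s) + K x"
    unfolding K_def using int(1) tail_moment_decomposition(1)[OF assms(1)]
    by (intro set_integral_Un) auto
  also have "(LINT s:{0..<x}|lborel. ?g s) = (LINT s:{0..x}|lborel. ?g s)"
    by (rule set_integral_discrete_difference[where X = "{x}"]) auto
  also have "\<dots> = integral {0..x} ?g"
    by (rule set_borel_integral_eq_integral(2)[OF int(2)])
  also have "\<dots> = x powr \<alpha> * (1 - williamson_transform \<alpha> F x)"
  proof (rule integral_unique)
    from has_integral_diff[OF powr_has_integral[OF \<alpha> order.refl assms(1)] williamson_has_integral[OF F \<alpha> assms(1)]]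
    show "(?g has_integral x powr \<alpha> * (1 - williamson_transform \<alpha> F x)) {0..x}"
      using \<alpha> by (simp add: algebra_simps)
  qed
  finally show ?thesis
    using tail_moment_decomposition(2)[of 0] \<alpha> by simp
qed

text \<open>Bounds on \<open>s f(s) / (1 - F(s))\<close> pass to the integrals against \<open>s\<^sup>\<alpha>\<^sup>-\<^sup>1 ds\<close>.\<close>

lemma tail_moment_bounds:
  assumes "x > 0" and "\<And>s. s \<ge> x \<Longrightarrow> c * (1 - F s) \<le> s * f s \<and> s * f s \<le> d * (1 - F s)"
  shows "c * K x \<le> \<alpha> * (LINT t:{x..}|lborel. t powr \<alpha> * f t)"
    and "\<alpha> * (LINT t:{x..}|lborel. t powr \<alpha> * f t) \<le> d * K x"
proof -
  note [measurable] = density_cdf_borel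
  let ?g = "\<lambda>s. \<alpha> * s powr (\<alpha> - 1) * (1 - F s)"
  have int: "set_integrable lborel {x..} ?g" "set_integrable lborel {x..} (\<lambda>t. t powr \<alpha> * f t)"
    using assms(1) by (auto intro: tail_moment_decomposition(1) moment_set_integrable)
  have "c * ?g s \<le> \<alpha> * (s powr \<alpha> * f s) \<and> \<alpha> * (s powr \<alpha> * f s) \<le> d * ?g s" if "s \<ge> x" for s
  proof -
    have "s powr \<alpha> = s * s powr (\<alpha> - 1)"
      using powr_mult_base[of s "\<alpha> - 1"] that \<open>x > 0\<close> by simp
    then show ?thesis
      using mult_left_mono[of "c * (1 - F s)" "s * f s" "\<alpha> * s powr (\<alpha> - 1)"]
        mult_left_mono[of "s * f s" "d * (1 - F s)" "\<alpha> * s powr (\<alpha> - 1)"] assms(2)[OF that] \<alpha>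
      by (simp add: mult_ac)
  qed
  then have "(LINT s:{x..}|lborel. c * ?g s) \<le> (LINT s:{x..}|lborel. \<alpha> * (s powr \<alpha> * f s))"
    "(LINT s:{x..}|lborel. \<alpha> * (s powr \<alpha> * f s)) \<le> (LINT s:{x..}|lborel. d * ?g s)"
    using int by (intro set_integral_mono set_integrable_mult_right; simp)+
  then show "c * K x \<le> \<alpha> * (LINT t:{x..}|lborel. t powr \<alpha> * f t)"
    "\<alpha> * (LINT t:{x..}|lborel. t powr \<alpha> * f t) \<le> d * K x"
    by (simp_all only: set_integral_mult_right K_def)
qed

lemma tail_integral_asymptotics:
  assumes "\<beta> > \<alpha>" and lt: "\<And>x. F x < 1"
    and lim: "((\<lambda>x. x * f x / (1 - F x)) \<longlongrightarrow> \<beta>) at_top"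
  shows "((\<lambda>x. K x / (x powr \<alpha> * (1 - F x))) \<longlongrightarrow> \<alpha> / (\<beta> - \<alpha>)) at_top"
    and "((\<lambda>x. x powr \<alpha> * (1 - F x)) \<longlongrightarrow> 0) at_top"
proof -
  let ?T = "\<lambda>x. LINT t:{x..}|lborel. t powr \<alpha> * f t"
  have T: "\<forall>\<^sub>F x in at_top. ?T x = x powr \<alpha> * (1 - F x) + K x"
    using eventually_ge_at_top[of 0] by eventually_elim (rule tail_moment_decomposition(2))
  have u: "\<forall>\<^sub>F x in at_top. x powr \<alpha> * (1 - F x) > 0"
    using eventually_gt_at_top[of 0] by eventually_elim (simp add: lt)
  have K: "\<forall>\<^sub>F x in at_top. K x \<ge> 0" by (simp add: tail_integral_nonneg)
  have sq: "\<forall>\<^sub>F x in at_top. (\<beta> - \<epsilon>) * K x \<le> \<alpha> * ?T x \<and> \<alpha> * ?T x \<le> (\<beta> + \<epsilon>) * K x"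
    if "\<epsilon> > 0" for \<epsilon>
  proof -
    have "\<forall>\<^sub>F s in at_top. \<bar>s * f s / (1 - F s) - \<beta>\<bar> < \<epsilon>"
      using tendstoD[OF lim that] by (simp add: dist_real_def)
    then obtain x0 where x0: "\<And>s. s \<ge> x0 \<Longrightarrow> \<bar>s * f s / (1 - F s) - \<beta>\<bar> < \<epsilon>"
      by (auto simp: eventually_at_top_linorder)
    have bd: "(\<beta> - \<epsilon>) * (1 - F s) \<le> s * f s \<and> s * f s \<le> (\<beta> + \<epsilon>) * (1 - F s)" if "s \<ge> x0" for s
    proof -
      have "\<beta> - \<epsilon> \<le> s * f s / (1 - F s)" "s * f s / (1 - F s) \<le> \<beta> + \<epsilon>"
        using x0[OF that] by (auto simp: abs_less_iff)
      with lt[of s] show ?thesis by (simp add: pos_le_divide_eq pos_divide_le_eq)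
    qed
    show ?thesis
      using eventually_ge_at_top[of x0] eventually_gt_at_top[of 0]
    proof eventually_elim
      case (elim x)
      then show ?case using tail_moment_bounds[of x "\<beta> - \<epsilon>" "\<beta> + \<epsilon>"] bd by simp
    qed
  qed
  show "((\<lambda>x. K x / (x powr \<alpha> * (1 - F x))) \<longlongrightarrow> \<alpha> / (\<beta> - \<alpha>)) at_top"
    "((\<lambda>x. x powr \<alpha> * (1 - F x)) \<longlongrightarrow> 0) at_top"
    using tail_ratio_limit[OF \<alpha> \<open>\<beta> > \<alpha>\<close> T u K tail_integral_tendsto_0 sq] by blast+
qed

end

section \<open>The renewal density\<close>

text \<open>The renewal density \<open>D\<close> in terms of \<open>p = m - K\<close> and \<open>u\<close>, the variables in which its expansion is
  computed: \<open>1 - G = p / x\<^sup>\<alpha>\<close>, \<open>F - G = (p - u) / x\<^sup>\<alpha>\<close> and \<open>S = 1 - F = u / x\<^sup>\<alpha>\<close>.\<close>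

lemma kendall_renewal_derivative_normalised:
  fixes \<alpha> m x f u p D S :: real
  assumes "x > 0" "u > 0" "p > 0" "m > 0"
    and D: "D = f / (p / x powr \<alpha>)\<^sup>2 + 2 * \<alpha> * ((p - u) / x powr \<alpha>)\<^sup>2 / (x * (p / x powr \<alpha>) ^ 3)"
    and S: "S = u / x powr \<alpha>"
  shows "1 / (x powr (2 * \<alpha> - 1) * S) * (D - 2 * \<alpha> * x powr (\<alpha> - 1) / m)
    = (x * f / S) / p\<^sup>2 + 2 * \<alpha> * ((p - u)\<^sup>2 / p ^ 3 - 1 / m) / u"
proof -
  define y where "y = x powr \<alpha>"
  have y: "y > 0" "x powr (\<alpha> - 1) = y / x" "x powr (2 * \<alpha> - 1) = y\<^sup>2 / x"
    using \<open>x > 0\<close> by (simp_all add: y_def powr_diff powr_add[symmetric] power2_eq_square)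
  show ?thesis
    unfolding D S y_def[symmetric] y(2,3) using assms(1-4) y(1)
    by (simp add: divide_simps) (simp add: algebra_simps eval_nat_numeral)
qed

theorem theorem12:
  fixes \<alpha> \<beta> m :: real
    and M :: "'a measure" and X :: "'a \<Rightarrow> real" and f F R :: "real \<Rightarrow> real"
  assumes "\<alpha> > 0"
    and "prob_space M"
    and "AE \<omega> in M. X \<omega> > 0"
    and "\<And>x. f x \<ge> 0"
    and "distributed M lborel X (\<lambda>x. ennreal (f x))"
    and "F = cdf (distr M borel X)"
    and "integrable M (\<lambda>\<omega>. X \<omega> powr \<alpha>)"
    and "m = (\<integral>\<omega>. X \<omega> powr \<alpha> \<partial>M)"
    and "R = kendall_renewal \<alpha> F"
    and "\<beta> > \<alpha>"
    and "((\<lambda>x. x * f x / (1 - F x)) \<longlongrightarrow> \<beta>) at_top"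
  shows "(\<forall>x. summable (\<lambda>n. kendall_power \<alpha> F n x)) \<and>
    (\<forall>x\<in>density_points F f. x > 0 \<longrightarrow> R differentiable (at x)) \<and>
    ((\<lambda>x. 1 / (x powr (2 * \<alpha> - 1) * (1 - F x)) *
          (deriv R x - 2 * \<alpha> * x powr (\<alpha> - 1) / m))
      \<longlongrightarrow> (2 * \<alpha> - \<beta>) * (3 * \<alpha> - \<beta>) / (m\<^sup>2 * (\<beta> - \<alpha>)))
     (inf at_top (principal (density_points F f)))"
proof -
  interpret prob_space M by fact
  have f_meas [measurable]: "f \<in> borel_measurable borel"
    by (rule distributed_real_measurable[OF assms(4) assms(5), unfolded measurable_lborel2])
  have X_meas [measurable]: "X \<in> borel_measurable M"
    by (rule distributed_measurable[OF assms(5), unfolded measurable_lborel1])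
  have law: "distr M borel X = density lborel f"
  proof -
    have "distr M borel X = distr M lborel X" by (rule distr_cong) (rule refl, simp, rule refl)
    also have "\<dots> = density lborel f" by (rule distributed_distr_eq_density[OF assms(5)])
    finally show ?thesis .
  qed
  have law_rd: "real_distribution (distr M borel X)" by (rule real_distribution_distr) simp
  then have law_prob: "prob_space (density lborel f)"
    unfolding law by (simp add: real_distribution_def)
  have F_cdf: "F = cdf (density lborel f)" using assms(6) law by simp
  have F: "distribution_function_nonneg F"
  proof -
    interpret L: real_distribution "distr M borel X" by fact
    have "F x = 0" if "x < 0" for x
    proof -
      have "F x = prob {\<omega> \<in> space M. X \<omega> \<le> x}"
        by (simp add: assms(6) cdf_def2 measure_distr vimage_def Int_def conj_commute)
      also have "\<dots> = 0"
        using assms(3) that by (subst prob_Collect_eq_0) (auto elim!: eventually_mono)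
      finally show ?thesis .
    qed
    then show ?thesis
      unfolding distribution_function_nonneg_def assms(6)
      by (intro conjI allI impI monoI L.cdf_nondecreasing L.cdf_is_right_cont L.cdf_lim_at_top_prob) auto
  qed
  \<comment> \<open>The moment is an integral over the whole line, the tail lemmas use \<open>{0..}\<close>. For \<open>t < 0\<close> the value
    \<open>t powr \<alpha>\<close> need not be \<open>0\<close>, so the density has to vanish there.\<close>
  have f_support: "AE t in lborel. t \<le> 0 \<longrightarrow> f t = 0"
  proof -
    have "AE t in distr M borel X. t > 0"
      using assms(3) by (subst AE_distr_iff) auto
    then show ?thesis
      unfolding law by (subst (asm) AE_density)
        (use assms(4) in \<open>auto elim!: eventually_mono intro: order.antisym simp: not_less\<close>)
  qed
  have m_eq: "AE t in lborel. f t * t powr \<alpha> = indicator {0..} t * (t powr \<alpha> * f t)"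
    using f_support by eventually_elim (auto simp: indicator_def)
  have moment: "set_integrable lborel {0..} (\<lambda>t. t powr \<alpha> * f t)"
  proof -
    have "integrable lborel (\<lambda>t. f t * t powr \<alpha>)"
      using assms(7) by (subst distributed_integrable[OF assms(5)]) (auto simp: assms(4))
    then show ?thesis
      unfolding set_integrable_def real_scaleR_def
      by (rule integrable_cong_AE[THEN iffD1, OF _ _ m_eq, rotated 2]) simp_all
  qed
  have m: "m = (LINT t:{0..}|lborel. t powr \<alpha> * f t)"
  proof -
    have "m = (\<integral>t. f t * t powr \<alpha> \<partial>lborel)"
      unfolding assms(8) by (rule distributed_integral[OF assms(5), symmetric]) (auto simp: assms(4))
    also have "\<dots> = (LINT t:{0..}|lborel. t powr \<alpha> * f t)"
      unfolding set_lebesgue_integral_def real_scaleR_def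
      by (rule integral_cong_AE[OF _ _ m_eq]) auto
    finally show ?thesis .
  qed
  have cont: "continuous_on {0..} F"
    using density_cdf_isCont[OF f_meas assms(4) law_prob F_cdf assms(1) moment]
    by (intro continuous_at_imp_continuous_on) auto

  \<comment> \<open>If \<open>F\<close> reached \<open>1\<close>, the quotient in the hypothesis would be \<open>0\<close> from then on, as a division by \<open>0\<close>,
    contradicting \<open>\<beta> > \<alpha> > 0\<close>.\<close>
  have lt: "F x < 1" for x
  proof (rule ccontr)
    assume "\<not> F x < 1"
    have "F s = 1" if "s \<ge> x" for s
      using \<open>\<not> F x < 1\<close> that F distribution_function_nonneg_bounds(2)[OF F, of s]
      by (force simp: distribution_function_nonneg_def mono_def)
    then have "((\<lambda>x. x * f x / (1 - F x)) \<longlongrightarrow> 0) at_top"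
      by (intro tendsto_eventually eventually_mono[OF eventually_ge_at_top[of x]]) auto
    with assms(11) have "\<beta> = 0" by (rule tendsto_unique[OF trivial_limit_at_top_linorder])
    with assms(1,10) show False by simp
  qed

  define G where "G = williamson_transform \<alpha> F"
  define K where "K = (\<lambda>x. LINT s:{x..}|lborel. \<alpha> * s powr (\<alpha> - 1) * (1 - F s))"
  define u where "u = (\<lambda>x. x powr \<alpha> * (1 - F x))"
  note density_facts = f_meas assms(4) law_prob F_cdf assms(1) moment
  have u_pos: "u x > 0" if "x > 0" for x
    using that lt[of x] by (simp add: u_def)
  have K_nonneg: "K x \<ge> 0" for x
    unfolding K_def by (rule tail_integral_nonneg[OF density_facts])
  have K_eq: "m - K x = x powr \<alpha> * (1 - G x)" if "x > 0" for x
    using tail_integral_eq_williamson[OF density_facts _ F, of x] that by (simp add: K_def m G_def)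
  have G_lt: "G x < 1" for x
    using williamson_le[OF F assms(1), of x] lt[of x] by (simp add: G_def)
  have mK: "m - K x > 0" if "x > 0" for x
    using K_eq[OF that] G_lt[of x] that by simp
  have "m > 0" using mK[of 1] K_nonneg[of 1] by simp

  have R_deriv: "(R has_real_derivative
      f x / (1 - G x)\<^sup>2 + 2 * \<alpha> * (F x - G x)\<^sup>2 / (x * (1 - G x) ^ 3)) (at x)"
    if "x \<in> density_points F f" "x > 0" for x
    using that kendall_renewal_has_derivative[OF F cont assms(1) lt, of x "f x"]
    by (simp add: density_points_def assms(9) G_def)

  have limit: "((\<lambda>x. (x * f x / (1 - F x)) / (m - K x)\<^sup>2 +
        2 * \<alpha> * ((m - K x - u x)\<^sup>2 / (m - K x) ^ 3 - 1 / m) / u x)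
      \<longlongrightarrow> (\<beta> + 2 * \<alpha> * (\<alpha> / (\<beta> - \<alpha>) - 2)) / m\<^sup>2) at_top"
  proof (rule renewal_density_expansion[OF assms(11)])
    show "(u \<longlongrightarrow> 0) at_top" "((\<lambda>x. K x / u x) \<longlongrightarrow> \<alpha> / (\<beta> - \<alpha>)) at_top"
      unfolding u_def K_def
      by (rule tail_integral_asymptotics[OF density_facts assms(10) lt assms(11)])+
    show "(K \<longlongrightarrow> 0) at_top"
      unfolding K_def by (rule tail_integral_tendsto_0[OF density_facts])
    show "\<forall>\<^sub>F x in at_top. u x > 0"
      using eventually_gt_at_top[of 0] by eventually_elim (rule u_pos)
  qed fact
  have const: "(\<beta> + 2 * \<alpha> * (\<alpha> / (\<beta> - \<alpha>) - 2)) / m\<^sup>2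
      = (2 * \<alpha> - \<beta>) * (3 * \<alpha> - \<beta>) / (m\<^sup>2 * (\<beta> - \<alpha>))"
    using assms(10) \<open>m > 0\<close> by (simp add: divide_simps) (simp add: algebra_simps power2_eq_square)
  have normalised: "1 / (x powr (2 * \<alpha> - 1) * (1 - F x)) * (deriv R x - 2 * \<alpha> * x powr (\<alpha> - 1) / m)
      = (x * f x / (1 - F x)) / (m - K x)\<^sup>2 + 2 * \<alpha> * ((m - K x - u x)\<^sup>2 / (m - K x) ^ 3 - 1 / m) / u x"
    if "x \<in> density_points F f" "x > 0" for x
  proof (rule kendall_renewal_derivative_normalised)
    have 1: "1 - G x = (m - K x) / x powr \<alpha>" "F x - G x = (m - K x - u x) / x powr \<alpha>"
      using K_eq[OF that(2)] that(2) by (auto simp: u_def field_simps)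
    show "deriv R x = f x / ((m - K x) / x powr \<alpha>)\<^sup>2
        + 2 * \<alpha> * ((m - K x - u x) / x powr \<alpha>)\<^sup>2 / (x * ((m - K x) / x powr \<alpha>) ^ 3)"
      using DERIV_imp_deriv[OF R_deriv[OF that]] by (simp only: 1)
    show "1 - F x = u x / x powr \<alpha>" using that(2) by (simp add: u_def)
  qed (use that u_pos mK \<open>m > 0\<close> in auto)

  show ?thesis
  proof (intro conjI allI ballI impI)
    show "summable (\<lambda>n. kendall_power \<alpha> F n x)" for x
      by (rule kendall_renewal_sums(1)[OF F cont assms(1) lt])
    show "R differentiable (at x)" if "x \<in> density_points F f" "x > 0" for x
      using R_deriv[OF that] by (auto simp: real_differentiable_def)
    let ?D = "inf at_top (principal (density_points F f))"
    have "\<forall>\<^sub>F x in ?D. x \<in> density_points F f \<and> x > 0"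
      unfolding eventually_inf_principal using eventually_gt_at_top[of 0]
      by eventually_elim simp
    then have "\<forall>\<^sub>F x in ?D. (x * f x / (1 - F x)) / (m - K x)\<^sup>2 +
          2 * \<alpha> * ((m - K x - u x)\<^sup>2 / (m - K x) ^ 3 - 1 / m) / u x
        = 1 / (x powr (2 * \<alpha> - 1) * (1 - F x)) * (deriv R x - 2 * \<alpha> * x powr (\<alpha> - 1) / m)"
      by eventually_elim (simp only: normalised)
    then show "((\<lambda>x. 1 / (x powr (2 * \<alpha> - 1) * (1 - F x)) *
          (deriv R x - 2 * \<alpha> * x powr (\<alpha> - 1) / m))
      \<longlongrightarrow> (2 * \<alpha> - \<beta>) * (3 * \<alpha> - \<beta>) / (m\<^sup>2 * (\<beta> - \<alpha>))) ?D"
      using tendsto_mono[OF inf_le1 limit] unfolding const by (rule Lim_transform_eventually[rotated])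
  qed
qed

end
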